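(* In IITT there is no expression $t$ such that $X{:}\mathsf{Set}_0\vdash t:X$, where $X{:}\mathsf{Set}_0$ is the context consisting of the single relevant binding of the variable $X$ with type $\mathsf{Set}_0$.
   Context: Irrelevant Intensional Type Theory (IITT) is defined as follows. Sorts are $\mathsf{Set}_k$ ($k\in\mathbb{N}$), with $\mathsf{Axiom}=\{(\mathsf{Set}_i,\mathsf{Set}_{i+1})\mid i\in\mathbb{N}\}$ and $\mathsf{Rule}=\{(\mathsf{Set}_i,\mathsf{Set}_j,\mathsf{Set}_{\max(i,j)})\mid i,j\in\mathbb{N}\}$. Annotations are $\star\in\{:,\div\}$ (relevant, irrelevant). Expressions: $t,u,T,U ::= s \mid (x\star U)\to^{s,s'}T \mid x \mid \lambda x\star U.\,t \mid t\star u$, where $(x\star U)\to^{s,s'}T$ is a relevant or irrelevant dependent function type annotated with the sort $s$ of its domain and $s'$ of its codomain, and $t\star u$ is relevant application (also written $t\,u$) or irrelevant application $t\div u$. Expressions are taken modulo $\alpha$-equivalence; $[u/x]t$ is capture-avoiding substitution. Contexts: $\Gamma ::= () \mid \Gamma.\,x\star T$ (variables distinct). Resurrection $\Gamma^{\oplus}$ replaces each binding $x\div T$ by $x:T$. Abbreviations: $\Gamma\vdash t\div T$ means $\Gamma^\oplus\vdash t:T$; $\Gamma\vdash t=t'\div T$ means $\Gamma\vdash t\div T$ and $\Gamma\vdash t'\div T$; $\Gamma\vdash T$ means $\Gamma\vdash T:s$ for some sort $s$; $\Gamma\vdash T=T'$ means $\Gamma\vdash T=T':s$ for some $s$. The judgements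 $\vdash\Gamma$, $\Gamma\vdash t:T$, $\Gamma\vdash t=t':T$ are defined mutually inductively by: (contexts) $\vdash()$; from $\vdash\Gamma$ and $\Gamma\vdash T$ infer $\vdash\Gamma.x\star T$. (typing) from $\vdash\Gamma$, $(s,s')\in\mathsf{Axiom}$ infer $\Gamma\vdash s:s'$; from $\Gamma\vdash U:s_1$, $\Gamma.x\star U\vdash T:s_2$, $(s_1,s_2,s_3)\in\mathsf{Rule}$ infer $\Gamma\vdash (x\star U)\to^{s_1,s_2}T:s_3$; from $\vdash\Gamma$ and $(x:U)\in\Gamma$ infer $\Gamma\vdash x:U$ (no variable rule for irrelevant bindings); from $\Gamma.x\star U\vdash t:T$ and $\Gamma\vdash (x\star U)\to^{s,s'}T$ infer $\Gamma\vdash \lambda x\star U.t:(x\star U)\to^{s,s'}T$; from $\Gamma\vdash t:(x\star U)\to^{s,s'}T$ and $\Gamma\vdash u\star U$ infer $\Gamma\vdash t\star u:[u/x]T$; from $\Gamma\vdash t:T$ and $\Gamma\vdash T=T'$ infer $\Gamma\vdash t:T'$. (equality) $\beta$: from $\Gamma.x\star U\vdash t:T$ and $\Gamma\vdash u\star U$ infer $\Gamma\vdash(\lambda x\star U.t)\star u=[u/x]t:[u/x]T$; $\eta$: from $\Gamma\vdash t:(x\star U)\to^{s,s'}T$ infer $\Gamma\vdash t=\lambda x\star U.(t\star x):(x\star U)\to^{s,s'}T$; reflexivity, symmetry, transitivity; from $\Gamma\vdash U=U':s_1$, $\Gamma.x\star U\vdash T=T':s_2$, $(s_1,s_2,s_3)\in\mathsf{Rule}$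 infer $\Gamma\vdash (x\star U)\to^{s_1,s_2}T=(x\star U')\to^{s_1,s_2}T':s_3$; from $\Gamma\vdash U=U':s_1$, $\Gamma.x\star U\vdash T:s_2$, $\Gamma.x\star U\vdash t=t':T$ infer $\Gamma\vdash\lambda x\star U.t=\lambda x\star U'.t':(x\star U)\to^{s_1,s_2}T$; from $\Gamma\vdash t=t':(x\star U)\to^{s,s'}T$ and $\Gamma\vdash u=u'\star U$ infer $\Gamma\vdash t\star u=t'\star u':[u/x]T$; from $\Gamma\vdash t=t':T$ and $\Gamma\vdash T=T'$ infer $\Gamma\vdash t=t':T'$. *)

theory Defs
  imports Main
begin

datatype sort = Set nat

datatype ann = Relevant | Irrelevant

text \<open>
  Expressions modulo alpha-equivalence, in de Bruijn representation: the last argument of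
  \<open>Fun\<close> and of \<open>Lam\<close> is the scope of the bound variable, which has index 0 there.
  \<open>Fun a s s' U T\<close> is the function type with annotation \<open>a\<close>, domain \<open>U\<close> of sort \<open>s\<close>
  and codomain \<open>T\<close> of sort \<open>s'\<close>.
\<close>

datatype exp =
    Sort sort
  | Fun ann sort sort exp exp
  | Var nat
  | Lam ann exp exp
  | App ann exp exp

definition Axiom :: "(sort \<times> sort) set" where
  "Axiom = {(Set i, Set (Suc i)) | i. True}"

definition Rule :: "(sort \<times> sort \<times> sort) set" where
  "Rule = {(Set i, Set j, Set (max i j)) | i j. True}"

text \<open>\<open>shift d c t\<close> renames the variables of \<open>t\<close> with index at least \<open>c\<close>, adding \<open>d\<close>.\<close>

primrec shift :: "nat \<Rightarrow> nat \<Rightarrow> exp \<Rightarrow> exp" where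
  "shift d c (Sort s) = Sort s"
| "shift d c (Fun a s s' U T) = Fun a s s' (shift d c U) (shift d (Suc c) T)"
| "shift d c (Var i) = Var (if i < c then i else i + d)"
| "shift d c (Lam a U t) = Lam a (shift d c U) (shift d (Suc c) t)"
| "shift d c (App a t u) = App a (shift d c t) (shift d c u)"

text \<open>
  \<open>subst k u t\<close> replaces variable \<open>k\<close> of \<open>t\<close> by \<open>u\<close> and removes \<open>k\<close> from the scope, so that
  larger indices drop by one. The expression \<open>u\<close> lives outside the innermost \<open>k\<close> binders and is
  shifted past them where it is inserted. Thus \<open>[u/x]t\<close> for the innermost variable is
  \<open>subst 0 u t\<close>.
\<close>

primrec subst :: "nat \<Rightarrow> exp \<Rightarrow> exp \<Rightarrow> exp" where
  "subst k u (Sort s) = Sort s"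
| "subst k u (Fun a s s' U T) = Fun a s s' (subst k u U) (subst (Suc k) u T)"
| "subst k u (Var i) =
     (if i < k then Var i else if i = k then shift k 0 u else Var (i - 1))"
| "subst k u (Lam a U t) = Lam a (subst k u U) (subst (Suc k) u t)"
| "subst k u (App a t v) = App a (subst k u t) (subst k u v)"

text \<open>
  The most recent binding is the head of the list; the type in a binding is an expression over
  the tail that follows it.
\<close>

type_synonym ctx = "(ann \<times> exp) list"

definition resurrect :: "ctx \<Rightarrow> ctx" where
  "resurrect \<Gamma> = map (\<lambda>(a, T). (Relevant, T)) \<Gamma>"

text \<open>
  A term with annotation \<open>a\<close> is typed in \<open>ann_ctx a \<Gamma>\<close>, so \<open>has_type (ann_ctx a \<Gamma>) u U\<close> is the
  judgement \<open>\<Gamma> \<turnstile> u \<star> U\<close>.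
\<close>

fun ann_ctx :: "ann \<Rightarrow> ctx \<Rightarrow> ctx" where
  "ann_ctx Relevant \<Gamma> = \<Gamma>"
| "ann_ctx Irrelevant \<Gamma> = resurrect \<Gamma>"

text \<open>
  The judgements \<open>\<Gamma> \<turnstile> T\<close> and \<open>\<Gamma> \<turnstile> T = T'\<close>, which leave the sort unspecified, appear as premises
  with a sort variable that does not occur in the conclusion. The congruence rule for application
  is split by annotation, since \<open>\<Gamma> \<turnstile> u = u' \<div> U\<close> consists of two typing judgements.
\<close>

inductive wf_ctx :: "ctx \<Rightarrow> bool"
  and has_type :: "ctx \<Rightarrow> exp \<Rightarrow> exp \<Rightarrow> bool"
  and eq_tm :: "ctx \<Rightarrow> exp \<Rightarrow> exp \<Rightarrow> exp \<Rightarrow> bool"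
where
  wf_empty: "wf_ctx []"
| wf_ext: "\<lbrakk>wf_ctx \<Gamma>; has_type \<Gamma> T (Sort s)\<rbrakk> \<Longrightarrow> wf_ctx ((a, T) # \<Gamma>)"

| ty_sort: "\<lbrakk>wf_ctx \<Gamma>; (s, s') \<in> Axiom\<rbrakk> \<Longrightarrow> has_type \<Gamma> (Sort s) (Sort s')"
| ty_fun: "\<lbrakk>has_type \<Gamma> U (Sort s1); has_type ((a, U) # \<Gamma>) T (Sort s2); (s1, s2, s3) \<in> Rule\<rbrakk>
    \<Longrightarrow> has_type \<Gamma> (Fun a s1 s2 U T) (Sort s3)"
| ty_var: "\<lbrakk>wf_ctx \<Gamma>; i < length \<Gamma>; \<Gamma> ! i = (Relevant, U)\<rbrakk>
    \<Longrightarrow> has_type \<Gamma> (Var i) (shift (Suc i) 0 U)"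
| ty_lam: "\<lbrakk>has_type ((a, U) # \<Gamma>) t T; has_type \<Gamma> (Fun a s s' U T) (Sort s0)\<rbrakk>
    \<Longrightarrow> has_type \<Gamma> (Lam a U t) (Fun a s s' U T)"
| ty_app: "\<lbrakk>has_type \<Gamma> t (Fun a s s' U T); has_type (ann_ctx a \<Gamma>) u U\<rbrakk>
    \<Longrightarrow> has_type \<Gamma> (App a t u) (subst 0 u T)"
| ty_conv: "\<lbrakk>has_type \<Gamma> t T; eq_tm \<Gamma> T T' (Sort s)\<rbrakk> \<Longrightarrow> has_type \<Gamma> t T'"

| eq_beta: "\<lbrakk>has_type ((a, U) # \<Gamma>) t T; has_type (ann_ctx a \<Gamma>) u U\<rbrakk>
    \<Longrightarrow> eq_tm \<Gamma> (App a (Lam a U t) u) (subst 0 u t) (subst 0 u T)"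
| eq_eta: "has_type \<Gamma> t (Fun a s s' U T)
    \<Longrightarrow> eq_tm \<Gamma> t (Lam a U (App a (shift 1 0 t) (Var 0))) (Fun a s s' U T)"
| eq_refl: "has_type \<Gamma> t T \<Longrightarrow> eq_tm \<Gamma> t t T"
| eq_sym: "eq_tm \<Gamma> t t' T \<Longrightarrow> eq_tm \<Gamma> t' t T"
| eq_trans: "\<lbrakk>eq_tm \<Gamma> t1 t2 T; eq_tm \<Gamma> t2 t3 T\<rbrakk> \<Longrightarrow> eq_tm \<Gamma> t1 t3 T"
| eq_fun: "\<lbrakk>eq_tm \<Gamma> U U' (Sort s1); eq_tm ((a, U) # \<Gamma>) T T' (Sort s2); (s1, s2, s3) \<in> Rule\<rbrakk>
    \<Longrightarrow> eq_tm \<Gamma> (Fun a s1 s2 U T) (Fun a s1 s2 U' T') (Sort s3)"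
| eq_lam: "\<lbrakk>eq_tm \<Gamma> U U' (Sort s1); has_type ((a, U) # \<Gamma>) T (Sort s2);
      eq_tm ((a, U) # \<Gamma>) t t' T\<rbrakk>
    \<Longrightarrow> eq_tm \<Gamma> (Lam a U t) (Lam a U' t') (Fun a s1 s2 U T)"
| eq_app_rel: "\<lbrakk>eq_tm \<Gamma> t t' (Fun Relevant s s' U T); eq_tm \<Gamma> u u' U\<rbrakk>
    \<Longrightarrow> eq_tm \<Gamma> (App Relevant t u) (App Relevant t' u') (subst 0 u T)"
| eq_app_irr: "\<lbrakk>eq_tm \<Gamma> t t' (Fun Irrelevant s s' U T);
      has_type (resurrect \<Gamma>) u U; has_type (resurrect \<Gamma>) u' U\<rbrakk>
    \<Longrightarrow> eq_tm \<Gamma> (App Irrelevant t u) (App Irrelevant t' u') (subst 0 u T)"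
| eq_conv: "\<lbrakk>eq_tm \<Gamma> t t' T; eq_tm \<Gamma> T T' (Sort s)\<rbrakk> \<Longrightarrow> eq_tm \<Gamma> t t' T'"

end

theory Submission
  imports Defs
begin

text \<open>
  Expressions are interpreted in the graph model of the untyped lambda calculus, whose points are
  the sets of tokens, so that \<open>\<beta>\<close> holds as an equation between points. Some points
  are codes of types, and a code denotes a partial equivalence relation on points. Predicativity
  lets the universes be built by recursion on the level. The elements of a function type are the
  points that respect the relations; for an irrelevant domain any two inhabitants count as related,
  so an irrelevant function is constant on its domain. Every derivable judgement holds in this model,
  and the model has a code in \<open>Set 0\<close> that denotes the empty relation. Interpreting \<open>X\<close> by that code
  shows that \<open>X\<close> has no inhabitant.
\<close>

section \<open>The graph model\<close>

text \<open>A token is a finite piece of information about a point. \<open>FnTok l b\<close> says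
  that every argument containing the finite set \<open>set l\<close> yields \<open>b\<close>; the
  other constructors serve as tags for codes of types.\<close>

datatype tok =
    FnTok "tok list" tok
  | EmptyTok
  | SortTok nat
  | PiTok ann
  | DomTok tok
  | CodTok tok

type_synonym point = "tok set"

definition app :: "point \<Rightarrow> point \<Rightarrow> point" where
  "app f x = {b. \<exists>l. set l \<subseteq> x \<and> FnTok l b \<in> f}"

definition lam :: "(point \<Rightarrow> point) \<Rightarrow> point" where
  "lam f = {FnTok l b | l b. b \<in> f (set l)}"

text \<open>The tags let the components be read back from the point, and \<open>PiTok\<close>
  separates it from the other codes even when \<open>A\<close> and \<open>F\<close> are
  empty.\<close>

definition pi_point :: "ann \<Rightarrow> point \<Rightarrow> point \<Rightarrow> point" where
  "pi_point m A F = insert (PiTok m) (DomTok ` A \<union> CodTok ` F)"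

definition sort_point :: "nat \<Rightarrow> point" where
  "sort_point j = {SortTok j}"

definition empty_point :: point where
  "empty_point = {EmptyTok}"

lemma pi_point_inject [simp]:
  "pi_point m A F = pi_point m' A' F' \<longleftrightarrow> m = m' \<and> A = A' \<and> F = F'"
proof
  assume eq: "pi_point m A F = pi_point m' A' F'"
  have "n = m \<longleftrightarrow> PiTok n \<in> pi_point m A F" "x \<in> A \<longleftrightarrow> DomTok x \<in> pi_point m A F"
    "x \<in> F \<longleftrightarrow> CodTok x \<in> pi_point m A F" for n x m A F
    by (auto simp: pi_point_def)
  then show "m = m' \<and> A = A' \<and> F = F'"
    using eq by (metis subsetI subset_antisym)
qed simp

lemma sort_point_inject [simp]: "sort_point i = sort_point j \<longleftrightarrow> i = j"
  by (auto simp: sort_point_def)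

lemma point_distinct [simp]:
  "pi_point m A F \<noteq> sort_point j" "sort_point j \<noteq> pi_point m A F"
  "pi_point m A F \<noteq> empty_point" "empty_point \<noteq> pi_point m A F"
  "sort_point j \<noteq> empty_point" "empty_point \<noteq> sort_point j"
  by (auto simp: pi_point_def sort_point_def empty_point_def)

section \<open>Interpretation of expressions\<close>

type_synonym env = "nat \<Rightarrow> point"

text \<open>Terms of both annotations are interpreted by the same \<open>lam\<close> and
  \<open>app\<close>; irrelevance enters only through the relations that codes denote.
  \<open>case_nat d \<rho>\<close> gives index 0 the value \<open>d\<close>.\<close>

primrec interp :: "exp \<Rightarrow> env \<Rightarrow> point" where
  "interp (Sort s) \<rho> = (case s of Set j \<Rightarrow> sort_point j)"
| "interp (Fun a s s' U T) \<rho> = pi_point a (interp U \<rho>) (lam (\<lambda>d. interp T (case_nat d \<rho>)))"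
| "interp (Var i) \<rho> = \<rho> i"
| "interp (Lam a U t) \<rho> = lam (\<lambda>d. interp t (case_nat d \<rho>))"
| "interp (App a t u) \<rho> = app (interp t \<rho>) (interp u \<rho>)"

lemma interp_mono: "(\<And>i. \<rho> i \<subseteq> \<rho>' i) \<Longrightarrow> interp t \<rho> \<subseteq> interp t \<rho>'"
proof (induction t arbitrary: \<rho> \<rho>')
  case (Fun a s s' U T)
  have "interp T (case_nat d \<rho>) \<subseteq> interp T (case_nat d \<rho>')" for d
    by (rule Fun.IH(2)) (use Fun.prems in \<open>auto split: nat.split\<close>)
  then show ?case
    using Fun.IH(1)[OF Fun.prems] by (fastforce simp: pi_point_def lam_def)
next
  case (Lam a U t)
  have "interp t (case_nat d \<rho>) \<subseteq> interp t (case_nat d \<rho>')" for d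
    by (rule Lam.IH(2)) (use Lam.prems in \<open>auto split: nat.split\<close>)
  then show ?case
    by (fastforce simp: lam_def)
next
  case (App a t u)
  then have "interp t \<rho> \<subseteq> interp t \<rho>'" "interp u \<rho> \<subseteq> interp u \<rho>'"
    by blast+
  then show ?case
    by (auto simp: app_def)
qed auto

section \<open>Continuity and the \<beta> law\<close>

definition finite_below :: "env \<Rightarrow> env \<Rightarrow> bool" where
  "finite_below \<sigma> \<rho> \<longleftrightarrow> (\<forall>i. finite (\<sigma> i) \<and> \<sigma> i \<subseteq> \<rho> i)"

text \<open>The argument in \<open>FnTok l c\<close> is already the finite set \<open>set l\<close>,
  so its approximation \<open>\<sigma> 0\<close> can be enlarged to \<open>set l\<close> by
  monotonicity, and only the tail of \<open>\<sigma>\<close> has to approximate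
  \<open>\<rho>\<close>.\<close>

lemma interp_continuous_lam:
  assumes IH: "\<And>\<rho> b. b \<in> interp t \<rho> \<Longrightarrow> \<exists>\<sigma>. finite_below \<sigma> \<rho> \<and> b \<in> interp t \<sigma>"
    and b: "b \<in> lam (\<lambda>d. interp t (case_nat d \<rho>))"
  shows "\<exists>\<sigma>. finite_below \<sigma> \<rho> \<and> b \<in> lam (\<lambda>d. interp t (case_nat d \<sigma>))"
proof -
  obtain l c where lc: "b = FnTok l c" "c \<in> interp t (case_nat (set l) \<rho>)"
    using b by (auto simp: lam_def)
  obtain \<sigma> where \<sigma>: "finite_below \<sigma> (case_nat (set l) \<rho>)" "c \<in> interp t \<sigma>"
    using IH[OF lc(2)] by blast
  have below: "\<sigma> i \<subseteq> case_nat (set l) \<rho> i" "finite (\<sigma> i)" for i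
    using \<sigma>(1) by (auto simp: finite_below_def)
  have "\<sigma> i \<subseteq> case_nat (set l) (\<lambda>i. \<sigma> (Suc i)) i" for i
    using below(1)[of i] by (cases i) auto
  then have "interp t \<sigma> \<subseteq> interp t (case_nat (set l) (\<lambda>i. \<sigma> (Suc i)))"
    by (rule interp_mono)
  moreover have "finite_below (\<lambda>i. \<sigma> (Suc i)) \<rho>"
    using below[of "Suc _"] by (auto simp: finite_below_def)
  ultimately show ?thesis
    using \<sigma>(2) lc(1) by (auto simp: lam_def)
qed

lemma finite_below_Un:
  assumes "finite_below \<sigma> \<rho>" "finite_below \<tau> \<rho>"
  shows "finite_below (\<lambda>i. \<sigma> i \<union> \<tau> i) \<rho>"
  using assms by (auto simp: finite_below_def)

lemma interp_continuous: "b \<in> interp t \<rho> \<Longrightarrow> \<exists>\<sigma>. finite_below \<sigma> \<rho> \<and> b \<in> interp t \<sigma>"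
proof (induction t arbitrary: \<rho> b)
  case (Sort s)
  have "finite_below (\<lambda>_. {}) \<rho>" by (simp add: finite_below_def)
  then show ?case using Sort by auto
next
  case (Var i)
  have "finite_below (\<lambda>j. if j = i then {b} else {}) \<rho>"
    using Var by (auto simp: finite_below_def)
  then show ?case by (intro exI[of _ "\<lambda>j. if j = i then {b} else {}"]) simp
next
  case (Fun a s s' U T)
  consider "b = PiTok a" | x where "b = DomTok x" "x \<in> interp U \<rho>"
    | x where "b = CodTok x" "x \<in> lam (\<lambda>d. interp T (case_nat d \<rho>))"
    using Fun.prems by (auto simp: pi_point_def)
  then show ?case
  proof cases
    case 1
    have "finite_below (\<lambda>_. {}) \<rho>" by (simp add: finite_below_def)
    then show ?thesis using 1 by (auto simp: pi_point_def)
  next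
    case 2
    then show ?thesis using Fun.IH(1)[of x \<rho>] by (auto simp: pi_point_def)
  next
    case 3
    then show ?thesis
      using interp_continuous_lam[OF Fun.IH(2), of x \<rho>] by (auto simp: pi_point_def)
  qed
next
  case (Lam a U t)
  then show ?case using interp_continuous_lam[OF Lam.IH(2), of b \<rho>] by simp
next
  case (App a t u)
  obtain l where l: "set l \<subseteq> interp u \<rho>" "FnTok l b \<in> interp t \<rho>"
    using App.prems by (auto simp: app_def)
  obtain \<sigma> where \<sigma>: "finite_below \<sigma> \<rho>" "FnTok l b \<in> interp t \<sigma>"
    using App.IH(1)[OF l(2)] by blast
  have "\<forall>x\<in>set l. \<exists>\<tau>. finite_below \<tau> \<rho> \<and> x \<in> interp u \<tau>"
    using App.IH(2) l(1) by blast
  then obtain \<tau> where \<tau>: "\<And>x. x \<in> set l \<Longrightarrow> finite_below (\<tau> x) \<rho> \<and> x \<in> interp u (\<tau> x)"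
    by metis
  \<comment> \<open>This joins the approximation for the function token with one for each argument
    token in \<open>l\<close>; as \<open>l\<close> is finite, the union stays finite.\<close>
  let ?\<upsilon> = "\<lambda>i. \<sigma> i \<union> (\<Union>x\<in>set l. \<tau> x i)"
  have "finite_below ?\<upsilon> \<rho>"
    by (rule finite_below_Un[OF \<sigma>(1)]) (use \<tau> in \<open>fastforce simp: finite_below_def\<close>)
  moreover have "interp t \<sigma> \<subseteq> interp t ?\<upsilon>"
    by (rule interp_mono) auto
  moreover have "interp u (\<tau> x) \<subseteq> interp u ?\<upsilon>" if "x \<in> set l" for x
    by (rule interp_mono) (use that in auto)
  then have "set l \<subseteq> interp u ?\<upsilon>"
    using \<tau> by blast
  ultimately show ?case
    using \<sigma>(2) by (intro exI[of _ ?\<upsilon>]) (auto simp: app_def)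
qed

text \<open>This is \<beta> in the model. \<open>lam\<close> records a function only at finite
  arguments: monotonicity gives one inclusion, and continuity recovers the values at arbitrary
  arguments.\<close>

lemma app_lam_interp [simp]:
  "app (lam (\<lambda>d. interp t (case_nat d \<rho>))) x = interp t (case_nat x \<rho>)" (is "?L = ?R")
proof
  have "interp t (case_nat (set l) \<rho>) \<subseteq> ?R" if "set l \<subseteq> x" for l
    by (rule interp_mono) (use that in \<open>auto split: nat.split\<close>)
  then show "?L \<subseteq> ?R"
    by (auto simp: app_def lam_def)
next
  show "?R \<subseteq> ?L"
  proof
    fix b assume "b \<in> ?R"
    then obtain \<sigma> where \<sigma>: "finite_below \<sigma> (case_nat x \<rho>)" "b \<in> interp t \<sigma>"
      using interp_continuous by blast
    have below: "finite (\<sigma> i)" "\<sigma> i \<subseteq> case_nat x \<rho> i" for i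
      using \<sigma>(1) by (auto simp: finite_below_def)
    obtain l where l: "set l = \<sigma> 0"
      using finite_list[OF below(1)] by blast
    have "\<sigma> i \<subseteq> case_nat (set l) \<rho> i" for i
      using below(2)[of i] l by (cases i) auto
    then have "interp t \<sigma> \<subseteq> interp t (case_nat (set l) \<rho>)"
      by (rule interp_mono)
    moreover have "set l \<subseteq> x"
      using below(2)[of 0] l by simp
    ultimately show "b \<in> ?L"
      using \<sigma>(2) by (auto simp: app_def lam_def)
  qed
qed

section \<open>Renaming and substitution as changes of environment\<close>

lemma interp_shift:
  "interp (shift d c t) \<rho> = interp t (\<lambda>i. if i < c then \<rho> i else \<rho> (i + d))"
proof (induction t arbitrary: c \<rho>)
  case (Fun a s s' U T)
  have "(\<lambda>i. if i < Suc c then case_nat x \<rho> i else case_nat x \<rho> (i + d))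
    = case_nat x (\<lambda>i. if i < c then \<rho> i else \<rho> (i + d))" for x
    by (rule ext) (auto split: nat.split)
  then show ?case by (simp only: shift.simps interp.simps Fun.IH)
next
  case (Lam a U t)
  have "(\<lambda>i. if i < Suc c then case_nat x \<rho> i else case_nat x \<rho> (i + d))
    = case_nat x (\<lambda>i. if i < c then \<rho> i else \<rho> (i + d))" for x
    by (rule ext) (auto split: nat.split)
  then show ?case by (simp only: shift.simps interp.simps Lam.IH)
qed simp_all

definition insert_env :: "nat \<Rightarrow> point \<Rightarrow> env \<Rightarrow> env" where
  "insert_env k x \<rho> = (\<lambda>i. if i < k then \<rho> i else if i = k then x else \<rho> (i - 1))"

lemma insert_env_0: "insert_env 0 x \<rho> = case_nat x \<rho>"
  by (rule ext) (auto simp: insert_env_def split: nat.split)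

lemma insert_env_Suc: "insert_env (Suc k) x (case_nat y \<rho>) = case_nat y (insert_env k x \<rho>)"
  by (rule ext) (auto simp: insert_env_def split: nat.split)

text \<open>The substituted expression lives outside the innermost \<open>k\<close> binders, hence
  its environment drops the first \<open>k\<close> values.\<close>

lemma interp_subst:
  "interp (subst k u t) \<rho> = interp t (insert_env k (interp u (\<lambda>i. \<rho> (i + k))) \<rho>)"
  by (induction t arbitrary: k \<rho>) (simp_all add: insert_env_Suc interp_shift, simp add: insert_env_def)

lemma interp_subst_0: "interp (subst 0 u t) \<rho> = interp t (case_nat (interp u \<rho>) \<rho>)"
  by (simp add: interp_subst insert_env_0)

section \<open>Codes of types\<close>

type_synonym point_rel = "point \<Rightarrow> point \<Rightarrow> bool"

fun irr :: "ann \<Rightarrow> point_rel \<Rightarrow> point_rel" where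
  "irr Relevant R = R"
| "irr Irrelevant R = (\<lambda>x y. R x x \<and> R y y)"

text \<open>Irrelevance changes which elements are identified, never which ones there are.\<close>

lemma irr_diag [simp]: "irr m R x x \<longleftrightarrow> R x x"
  by (cases m) auto

definition per :: "point_rel \<Rightarrow> bool" where
  "per R \<longleftrightarrow> symp R \<and> transp R"

lemma perI: "(\<And>x y. R x y \<Longrightarrow> R y x) \<Longrightarrow> (\<And>x y z. R x y \<Longrightarrow> R y z \<Longrightarrow> R x z) \<Longrightarrow> per R"
  unfolding per_def symp_def transp_def by iprover

lemma per_sym: "per R \<Longrightarrow> R x y \<Longrightarrow> R y x"
  using sympD[of R x y] by (simp add: per_def)

lemma per_trans: "per R \<Longrightarrow> R x y \<Longrightarrow> R y z \<Longrightarrow> R x z"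
  using transpD[of R x y z] by (simp add: per_def)

lemma per_refl: "per R \<Longrightarrow> R x y \<Longrightarrow> R x x" "per R \<Longrightarrow> R x y \<Longrightarrow> R y y"
  using per_sym[of R] per_trans[of R] by metis+

lemma per_irr: "per R \<Longrightarrow> per (irr m R)"
proof (cases m)
  case Irrelevant
  show ?thesis
    unfolding Irrelevant irr.simps by (rule perI) blast+
qed simp

lemma per_empty: "per (\<lambda>_ _. False)"
  by (simp add: per_def symp_def transp_def)

text \<open>
  A point that codes a type determines a tree, and two points are equal types if they have the same
  tree. Comparing only the relations of the trees would not do, since the relation of a function
  type does not determine that of its domain. Normalising \<open>S\<close> to \<open>SEmpty\<close> outside the domain makes the
  tree of a point unique.
\<close>

datatype sem = SEmpty | SSet nat | SPi ann sem "point \<Rightarrow> sem"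

text \<open>\<open>P\<close> supplies the relations of the universes, which are constructed only
  later by recursion on the level.\<close>

primrec El :: "(nat \<Rightarrow> point_rel) \<Rightarrow> sem \<Rightarrow> point_rel" where
  "El P SEmpty = (\<lambda>_ _. False)"
| "El P (SSet j) = P j"
| "El P (SPi m c S) = (\<lambda>f g. \<forall>x y. irr m (El P c) x y \<longrightarrow> El P (S x) (app f x) (app g y))"

text \<open>Since \<open>El P c\<close> is a function of the tree \<open>c\<close>, an ordinary
  inductive definition replaces the usual induction-recursion of codes and their relations. The
  bound \<open>j < k\<close> expresses predicativity.\<close>

inductive type_code :: "(nat \<Rightarrow> point_rel) \<Rightarrow> nat \<Rightarrow> point \<Rightarrow> sem \<Rightarrow> bool" for P k where
  type_code_empty: "type_code P k empty_point SEmpty"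
| type_code_sort: "j < k \<Longrightarrow> type_code P k (sort_point j) (SSet j)"
| type_code_pi: "\<lbrakk>type_code P k A c;
      \<And>x. El P c x x \<Longrightarrow> type_code P k (app F x) (S x);
      \<And>x. \<not> El P c x x \<Longrightarrow> S x = SEmpty;
      \<And>x y. irr m (El P c) x y \<Longrightarrow> S x = S y\<rbrakk>
    \<Longrightarrow> type_code P k (pi_point m A F) (SPi m c S)"

inductive_cases type_code_emptyE: "type_code P k empty_point c"
inductive_cases type_code_sortE: "type_code P k (sort_point j) c"
inductive_cases type_code_piE: "type_code P k (pi_point m A F) c"

text \<open>A code fixes its components, so the domains have the same tree by induction; the
  families then agree on the domain by induction and elsewhere by the value
  \<open>SEmpty\<close>.\<close>

lemma type_code_unique: "type_code P k A c \<Longrightarrow> type_code P k' A c' \<Longrightarrow> c = c'"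
proof (induction arbitrary: c' rule: type_code.induct)
  case type_code_empty
  then show ?case by (auto elim: type_code_emptyE)
next
  case (type_code_sort j)
  then show ?case by (auto elim: type_code_sortE)
next
  case (type_code_pi A c F S m)
  from type_code_pi.prems obtain d S' where d: "c' = SPi m d S'" "type_code P k' A d"
    and S': "\<And>x. El P d x x \<Longrightarrow> type_code P k' (app F x) (S' x)"
      "\<And>x. \<not> El P d x x \<Longrightarrow> S' x = SEmpty"
    by (auto elim: type_code_piE)
  have "c = d"
    using type_code_pi.IH(1) d(2) .
  moreover have "S x = S' x" for x
    using type_code_pi.IH(2) type_code_pi.hyps(3) S' \<open>c = d\<close> by (cases "El P c x x") auto
  ultimately show ?case
    using d(1) by auto
qed

text \<open>A tree obtained at level \<open>k\<close> mentions \<open>SSet j\<close> only for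
  \<open>j < k\<close>, so no other entry of \<open>P\<close> is consulted. Raising the level to
  \<open>k'\<close> yields cumulativity.\<close>

lemma type_code_cong:
  assumes "type_code P k A c" "\<And>j. j < k \<Longrightarrow> P j = Q j" "k \<le> k'"
  shows "type_code Q k' A c \<and> El P c = El Q c"
  using assms(1)
proof (induction rule: type_code.induct)
  case (type_code_sort j)
  then show ?case using assms(2,3) by (auto intro: type_code.type_code_sort)
next
  case (type_code_pi A c F S m)
  have El_S: "El P (S x) = El Q (S x)" for x
    using type_code_pi.IH(2) type_code_pi.hyps(3)[of x] by (cases "El P c x x") auto
  have "type_code Q k' (pi_point m A F) (SPi m c S)"
    using type_code_pi by (intro type_code.type_code_pi) auto
  moreover have "El P (SPi m c S) = El Q (SPi m c S)"
    using type_code_pi.IH(1) by (simp add: El_S)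
  ultimately show ?case ..
qed (auto intro: type_code.intros)

lemma El_per:
  assumes "type_code P k A c" "\<And>j. per (P j)"
  shows "per (El P c)"
  using assms(1)
proof (induction rule: type_code.induct)
  case (type_code_pi A c F S m)
  have irr: "per (irr m (El P c))"
    using type_code_pi.IH(1) by (rule per_irr)
  have per_S: "per (El P (S x))" for x
    using type_code_pi.IH(2) type_code_pi.hyps(3)[of x]
    by (cases "El P c x x") (simp_all add: per_empty)
  show ?case
  proof (rule perI)
    fix f g assume fg: "El P (SPi m c S) f g"
    show "El P (SPi m c S) g f"
      unfolding El.simps
    proof (intro allI impI)
      fix x y assume xy: "irr m (El P c) x y"
      then have "El P (S y) (app f y) (app g x)"
        using fg per_sym[OF irr xy] by auto
      \<comment> \<open>Compatibility of \<open>S\<close> with related arguments moves the relation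
        from the fibre over \<open>y\<close> to the fibre over \<open>x\<close>.\<close>
      then show "El P (S x) (app g x) (app f y)"
        using per_sym[OF per_S] type_code_pi.hyps(4)[OF xy] by simp
    qed
  next
    fix f g h assume fg: "El P (SPi m c S) f g" and gh: "El P (SPi m c S) g h"
    show "El P (SPi m c S) f h"
      unfolding El.simps
    proof (intro allI impI)
      fix x y assume xy: "irr m (El P c) x y"
      have "El P (S x) (app f x) (app g x)" "El P (S x) (app g x) (app h y)"
        using fg gh xy per_refl(1)[OF irr xy] by auto
      then show "El P (S x) (app f x) (app h y)"
        by (rule per_trans[OF per_S])
    qed
  qed
qed (simp_all add: assms(2) per_empty)

section \<open>The universes\<close>

primrec univs_below :: "nat \<Rightarrow> nat \<Rightarrow> point_rel" where
  "univs_below 0 = (\<lambda>_ _ _. False)"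
| "univs_below (Suc k) = (univs_below k)
     (k := \<lambda>A B. \<exists>c. type_code (univs_below k) k A c \<and> type_code (univs_below k) k B c)"

text \<open>The relation of level \<open>j\<close> first appears at stage \<open>Suc j\<close>,
  built from the universes below it; later stages leave it unchanged.\<close>

definition univ :: "nat \<Rightarrow> point_rel" where
  "univ j = univs_below (Suc j) j"

lemma univs_below_eq: "j < k \<Longrightarrow> univs_below k j = univ j"
  by (induction k) (auto simp: univ_def less_Suc_eq)

abbreviation El' :: "sem \<Rightarrow> point_rel" where
  "El' \<equiv> El univ"

abbreviation type_at :: "nat \<Rightarrow> point \<Rightarrow> sem \<Rightarrow> bool" where
  "type_at \<equiv> type_code univ"

text \<open>Being a code at level \<open>j\<close> depends only on the universes below
  \<open>j\<close>, where \<open>univs_below j\<close> and \<open>univ\<close> coincide; so the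
  limit family \<open>univ\<close> can replace the stages.\<close>

lemma univ_iff: "univ j A B \<longleftrightarrow> (\<exists>c. type_at j A c \<and> type_at j B c)"
proof -
  have "type_code (univs_below j) j C c \<longleftrightarrow> type_at j C c" for C c
    using type_code_cong[where P = "univs_below j" and Q = univ and k = j and k' = j]
      type_code_cong[where Q = "univs_below j" and P = univ and k = j and k' = j]
    by (auto simp: univs_below_eq)
  then show ?thesis
    by (simp add: univ_def)
qed

lemma per_univ: "per (univ j)"
  by (rule perI) (auto simp: univ_iff dest: type_code_unique)

lemma per_El': "type_at k A c \<Longrightarrow> per (El' c)"
  by (rule El_per[OF _ per_univ])

lemma type_at_mono: "type_at k A c \<Longrightarrow> k \<le> k' \<Longrightarrow> type_at k' A c"
  using type_code_cong[OF _ refl] by blast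

text \<open>Common trees of the individual fibres are assembled into one family \<open>S\<close>;
  uniqueness of trees makes the choice coherent.\<close>

lemma type_at_piI:
  assumes A: "type_at k A c" "type_at k A' c"
    and F: "\<And>x y. irr m (El' c) x y \<Longrightarrow> \<exists>d. type_at k (app F x) d \<and> type_at k (app F' y) d"
  shows "\<exists>S. type_at k (pi_point m A F) (SPi m c S) \<and> type_at k (pi_point m A' F') (SPi m c S)"
proof -
  define S where "S x = (if El' c x x then THE d. type_at k (app F x) d else SEmpty)" for x
  have irr: "per (irr m (El' c))"
    using per_irr per_El' A by blast
  have S_eq: "S x = d" if "El' c x x" "type_at k (app F x) d" for x d
    using that type_code_unique unfolding S_def by (auto intro!: the_equality)
  have F_S: "type_at k (app F x) (S x)" "type_at k (app F' y) (S x)" if "irr m (El' c) x y" for x y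
  proof -
    have "El' c x x"
      using per_refl(1)[OF irr that] by simp
    with F[OF that] show "type_at k (app F x) (S x)" "type_at k (app F' y) (S x)"
      using S_eq by auto
  qed
  \<comment> \<open>Both are trees of the point \<open>app F' y\<close>.\<close>
  have compat: "S x = S y" if "irr m (El' c) x y" for x y
    using F_S(2)[OF that] F_S(2)[OF per_refl(2)[OF irr that]] by (rule type_code_unique)
  have outside: "S x = SEmpty" if "\<not> El' c x x" for x
    using that by (simp add: S_def)
  have "type_at k (pi_point m A F) (SPi m c S)"
    by (rule type_code_pi[OF A(1) F_S(1)[of x x for x] outside compat]) simp_all
  moreover have "type_at k (pi_point m A' F') (SPi m c S)"
    by (rule type_code_pi[OF A(2) F_S(2)[of x x for x] outside compat]) simp_all
  ultimately show ?thesis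
    by blast
qed

definition is_type :: "point \<Rightarrow> sem \<Rightarrow> bool" where
  "is_type A c \<longleftrightarrow> (\<exists>k. type_at k A c)"

lemma is_type_unique: "is_type A c \<Longrightarrow> is_type A c' \<Longrightarrow> c = c'"
  unfolding is_type_def using type_code_unique by blast

lemma is_type_per: "is_type A c \<Longrightarrow> per (El' c)"
  unfolding is_type_def using per_El' by blast

lemma is_type_at: "type_at k A c \<Longrightarrow> is_type A c"
  unfolding is_type_def by blast

lemma is_type_sort [simp]: "is_type (sort_point j) c \<longleftrightarrow> c = SSet j"
  unfolding is_type_def by (auto elim: type_code_sortE intro: type_code_sort)

lemma is_type_piE:
  assumes "is_type (pi_point m A F) c"
  obtains d S where "c = SPi m d S" "is_type A d"
    "\<And>x. El' d x x \<Longrightarrow> is_type (app F x) (S x)"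
    "\<And>x y. irr m (El' d) x y \<Longrightarrow> S x = S y"
proof -
  obtain k where "type_at k (pi_point m A F) c"
    using assms by (auto simp: is_type_def)
  then obtain d S where "c = SPi m d S" "type_at k A d"
    "\<And>x. El' d x x \<Longrightarrow> type_at k (app F x) (S x)"
    "\<And>x y. irr m (El' d) x y \<Longrightarrow> S x = S y"
    using type_code_piE by metis
  then show thesis
    by (rule that[OF _ is_type_at is_type_at])
qed

section \<open>Validity of the judgements\<close>

definition type_eq :: "exp \<Rightarrow> env \<Rightarrow> env \<Rightarrow> sem \<Rightarrow> bool" where
  "type_eq T \<rho> \<rho>' c \<longleftrightarrow> is_type (interp T \<rho>) c \<and> is_type (interp T \<rho>') c"

fun env_rel :: "ctx \<Rightarrow> env \<Rightarrow> env \<Rightarrow> bool" where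
  "env_rel [] \<rho> \<rho>' \<longleftrightarrow> True"
| "env_rel ((a, T) # \<Gamma>) \<rho> \<rho>' \<longleftrightarrow> env_rel \<Gamma> (\<lambda>i. \<rho> (Suc i)) (\<lambda>i. \<rho>' (Suc i)) \<and>
     (\<exists>c. type_eq T (\<lambda>i. \<rho> (Suc i)) (\<lambda>i. \<rho>' (Suc i)) c \<and> irr a (El' c) (\<rho> 0) (\<rho>' 0))"

fun valid_ctx :: "ctx \<Rightarrow> bool" where
  "valid_ctx [] \<longleftrightarrow> True"
| "valid_ctx ((a, T) # \<Gamma>) \<longleftrightarrow>
     valid_ctx \<Gamma> \<and> (\<forall>\<rho> \<rho>'. env_rel \<Gamma> \<rho> \<rho>' \<longrightarrow> (\<exists>c. type_eq T \<rho> \<rho>' c))"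

text \<open>
  Validity includes that of the context: from \<open>\<Gamma> \<turnstile> u \<div> U\<close> alone, the type \<open>U\<close> need
  not have the same meaning in environments related over \<open>\<Gamma>\<close>, because that judgement only concerns
  the resurrected context.
\<close>

definition valid_eq :: "ctx \<Rightarrow> exp \<Rightarrow> exp \<Rightarrow> exp \<Rightarrow> bool" where
  "valid_eq \<Gamma> t t' T \<longleftrightarrow> valid_ctx \<Gamma> \<and>
     (\<forall>\<rho> \<rho>'. env_rel \<Gamma> \<rho> \<rho>' \<longrightarrow>
        (\<exists>c. type_eq T \<rho> \<rho>' c \<and> El' c (interp t \<rho>) (interp t' \<rho>')))"

lemma type_eq_per: "type_eq T \<rho> \<rho>' c \<Longrightarrow> per (El' c)"
  unfolding type_eq_def using is_type_per by blast

lemma env_rel_sym: "env_rel \<Gamma> \<rho> \<rho>' \<Longrightarrow> env_rel \<Gamma> \<rho>' \<rho>"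
proof (induction \<Gamma> \<rho> \<rho>' rule: env_rel.induct)
  case (2 a T \<Gamma> \<rho> \<rho>')
  then obtain c where c: "type_eq T (\<lambda>i. \<rho> (Suc i)) (\<lambda>i. \<rho>' (Suc i)) c" "irr a (El' c) (\<rho> 0) (\<rho>' 0)"
    by auto
  then have "irr a (El' c) (\<rho>' 0) (\<rho> 0)"
    using per_sym per_irr type_eq_per by blast
  then show ?case
    using 2 c by (auto simp: type_eq_def)
qed simp

lemma env_rel_refl: "env_rel \<Gamma> \<rho> \<rho>' \<Longrightarrow> env_rel \<Gamma> \<rho> \<rho>"
proof (induction \<Gamma> \<rho> \<rho>' rule: env_rel.induct)
  case (2 a T \<Gamma> \<rho> \<rho>')
  then obtain c where c: "type_eq T (\<lambda>i. \<rho> (Suc i)) (\<lambda>i. \<rho>' (Suc i)) c" "irr a (El' c) (\<rho> 0) (\<rho>' 0)"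
    by auto
  then have "irr a (El' c) (\<rho> 0) (\<rho> 0)"
    using per_refl(1) per_irr type_eq_per by blast
  then show ?case
    using 2 c by (auto simp: type_eq_def)
qed simp

lemma env_rel_refl': "env_rel \<Gamma> \<rho> \<rho>' \<Longrightarrow> env_rel \<Gamma> \<rho>' \<rho>'"
  using env_rel_refl env_rel_sym by blast

lemma resurrect_simps [simp]:
  "resurrect [] = []" "resurrect ((a, T) # \<Gamma>) = (Relevant, T) # resurrect \<Gamma>"
  by (simp_all add: resurrect_def)

text \<open>Resurrection asks for related values where an irrelevant binding asks only for two
  inhabitants. The two demands coincide when an environment is compared with itself, hence the
  restriction to the diagonal.\<close>

lemma env_rel_resurrect: "env_rel \<Gamma> \<rho> \<rho> \<Longrightarrow> env_rel (resurrect \<Gamma>) \<rho> \<rho>"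
proof (induction \<Gamma> arbitrary: \<rho>)
  case (Cons b \<Gamma>)
  then show ?case by (cases b) auto
qed simp

lemma env_rel_nth:
  assumes "env_rel \<Gamma> \<rho> \<rho>'" "i < length \<Gamma>" "\<Gamma> ! i = (Relevant, U)"
  shows "\<exists>c. type_eq (shift (Suc i) 0 U) \<rho> \<rho>' c \<and> El' c (\<rho> i) (\<rho>' i)"
  using assms
proof (induction \<Gamma> arbitrary: i \<rho> \<rho>')
  case (Cons b \<Gamma>)
  obtain a T where b: "b = (a, T)"
    by (cases b)
  show ?case
  proof (cases i)
    case 0
    then show ?thesis
      using Cons.prems b by (auto simp: type_eq_def interp_shift)
  next
    case (Suc j)
    then show ?thesis
      using Cons.IH[of "\<lambda>i. \<rho> (Suc i)" "\<lambda>i. \<rho>' (Suc i)" j] Cons.prems b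
      by (auto simp: type_eq_def interp_shift)
  qed
qed simp

lemma valid_ctxD: "valid_eq \<Gamma> t t' T \<Longrightarrow> valid_ctx \<Gamma>"
  by (simp add: valid_eq_def)

lemma valid_eqD:
  "valid_eq \<Gamma> t t' T \<Longrightarrow> env_rel \<Gamma> \<rho> \<rho>' \<Longrightarrow>
    \<exists>c. type_eq T \<rho> \<rho>' c \<and> El' c (interp t \<rho>) (interp t' \<rho>')"
  by (simp add: valid_eq_def)

text \<open>A point has at most one tree, so the tree supplied by validity is whichever tree of
  \<open>T\<close> is at hand.\<close>

lemma valid_eq_El:
  assumes "valid_eq \<Gamma> t t' T" "env_rel \<Gamma> \<rho> \<rho>'" "is_type (interp T \<rho>) c \<or> is_type (interp T \<rho>') c"
  shows "El' c (interp t \<rho>) (interp t' \<rho>')"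
  using valid_eqD[OF assms(1,2)] assms(3) is_type_unique unfolding type_eq_def by blast

lemma env_rel_Cons:
  assumes "env_rel \<Gamma> \<rho> \<rho>'" "type_eq U \<rho> \<rho>' c" "irr a (El' c) x y"
  shows "env_rel ((a, U) # \<Gamma>) (case_nat x \<rho>) (case_nat y \<rho>')"
  using assms by auto

section \<open>Semantic counterparts of the rules\<close>

lemma valid_eq_sortD:
  assumes "valid_eq \<Gamma> T T' (Sort (Set j))" "env_rel \<Gamma> \<rho> \<rho>'"
  shows "\<exists>c. type_at j (interp T \<rho>) c \<and> type_at j (interp T' \<rho>') c"
  using valid_eqD[OF assms] by (auto simp: type_eq_def univ_iff)

lemma valid_eq_sortI:
  assumes "valid_ctx \<Gamma>"
    "\<And>\<rho> \<rho>'. env_rel \<Gamma> \<rho> \<rho>' \<Longrightarrow> \<exists>c. type_at j (interp T \<rho>) c \<and> type_at j (interp T' \<rho>') c"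
  shows "valid_eq \<Gamma> T T' (Sort (Set j))"
  using assms by (simp add: valid_eq_def type_eq_def univ_iff)

text \<open>For an irrelevant argument, membership at \<open>\<rho>\<close> and at
  \<open>\<rho>'\<close> is obtained separately, each environment being related to itself over the
  resurrected context; \<open>irr\<close> asks for no more.\<close>

lemma valid_eq_ann:
  assumes "valid_eq (ann_ctx a \<Gamma>) u u U" "env_rel \<Gamma> \<rho> \<rho>'" "type_eq U \<rho> \<rho>' c"
  shows "irr a (El' c) (interp u \<rho>) (interp u \<rho>')"
proof (cases a)
  case Relevant
  then show ?thesis
    using valid_eq_El[of \<Gamma> u u U \<rho> \<rho>' c] assms by (simp add: type_eq_def)
next
  case Irrelevant
  have "env_rel (resurrect \<Gamma>) \<rho> \<rho>" "env_rel (resurrect \<Gamma>) \<rho>' \<rho>'"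
    using env_rel_resurrect env_rel_refl[OF assms(2)] env_rel_refl'[OF assms(2)] by blast+
  then show ?thesis
    using valid_eq_El[of "resurrect \<Gamma>" u u U] assms(1,3) Irrelevant by (simp add: type_eq_def)
qed

lemma valid_eq_fun:
  assumes U: "valid_eq \<Gamma> U U' (Sort (Set i))" and T: "valid_eq ((a, U) # \<Gamma>) T T' (Sort (Set j))"
  shows "valid_eq \<Gamma> (Fun a s1 s2 U T) (Fun a s1 s2 U' T') (Sort (Set (max i j)))"
proof (rule valid_eq_sortI)
  show "valid_ctx \<Gamma>"
    using U by (rule valid_ctxD)
next
  fix \<rho> \<rho>' assume \<rho>: "env_rel \<Gamma> \<rho> \<rho>'"
  obtain c where c: "type_at i (interp U \<rho>) c" "type_at i (interp U' \<rho>') c"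
    using valid_eq_sortD[OF U \<rho>] by blast
  \<comment> \<open>The premise on \<open>U\<close> compares it at \<open>\<rho>\<close> with
    \<open>U'\<close> at \<open>\<rho>'\<close>. Extending the environments requires comparing
    \<open>U\<close> with itself, which validity of the extended context provides.\<close>
  have "type_eq U \<rho> \<rho>' c"
    using valid_ctxD[OF T] \<rho> is_type_at[OF c(1)] is_type_unique
    unfolding type_eq_def valid_ctx.simps by blast
  then have *: "\<exists>d. type_at j (interp T (case_nat x \<rho>)) d \<and> type_at j (interp T' (case_nat y \<rho>')) d"
    if "irr a (El' c) x y" for x y
    using valid_eq_sortD[OF T env_rel_Cons[OF \<rho> _ that]] by blast
  have "\<exists>S. type_at (max i j) (interp (Fun a s1 s2 U T) \<rho>) (SPi a c S) \<and>
      type_at (max i j) (interp (Fun a s1 s2 U' T') \<rho>') (SPi a c S)"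
    unfolding interp.simps
  proof (rule type_at_piI)
    show "type_at (max i j) (interp U \<rho>) c" "type_at (max i j) (interp U' \<rho>') c"
      using c type_at_mono by simp_all
    show "\<exists>d. type_at (max i j) (app (lam (\<lambda>d. interp T (case_nat d \<rho>))) x) d \<and>
        type_at (max i j) (app (lam (\<lambda>d. interp T' (case_nat d \<rho>'))) y) d"
      if "irr a (El' c) x y" for x y
      using *[OF that] type_at_mono[OF _ max.cobounded2] unfolding app_lam_interp by blast
  qed
  then show "\<exists>c. type_at (max i j) (interp (Fun a s1 s2 U T) \<rho>) c \<and>
      type_at (max i j) (interp (Fun a s1 s2 U' T') \<rho>') c"
    by blast
qed

text \<open>The tree \<open>c\<close> is shared, so one \<open>d\<close> and one \<open>S\<close>
  serve both environments; invariance of \<open>S\<close> lets the fibre over \<open>y\<close> be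
  indexed by the related \<open>x\<close>.\<close>

lemma type_eq_funE:
  assumes "type_eq (Fun a s s' U T) \<rho> \<rho>' c"
  obtains d S where "c = SPi a d S" "type_eq U \<rho> \<rho>' d"
    "\<And>x y. irr a (El' d) x y \<Longrightarrow> is_type (interp T (case_nat x \<rho>)) (S x)"
    "\<And>x y. irr a (El' d) x y \<Longrightarrow> is_type (interp T (case_nat y \<rho>')) (S x)"
proof -
  obtain d S where d: "c = SPi a d S" "is_type (interp U \<rho>) d"
      "\<And>x. El' d x x \<Longrightarrow> is_type (interp T (case_nat x \<rho>)) (S x)"
      "\<And>x y. irr a (El' d) x y \<Longrightarrow> S x = S y"
    using assms unfolding type_eq_def interp.simps by (auto elim: is_type_piE)
  obtain d' S' where "c = SPi a d' S'" "is_type (interp U \<rho>') d'"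
      "\<And>x. El' d' x x \<Longrightarrow> is_type (interp T (case_nat x \<rho>')) (S' x)"
    using assms unfolding type_eq_def interp.simps by (auto elim: is_type_piE)
  then have d': "is_type (interp U \<rho>') d"
      "\<And>x. El' d x x \<Longrightarrow> is_type (interp T (case_nat x \<rho>')) (S x)"
    using d(1) by auto
  have "El' d x x" "El' d y y" if "irr a (El' d) x y" for x y
    using per_refl[OF per_irr[OF is_type_per[OF d(2)]] that] by auto
  then show thesis
    using that d d' unfolding type_eq_def by metis
qed

text \<open>The value of an abstraction is determined by its body, so \<open>U'\<close> is arbitrary
  and one lemma serves both the typing and the congruence rule.\<close>

lemma valid_eq_lam:
  assumes t: "valid_eq ((a, U) # \<Gamma>) t t' T"
    and ty: "valid_eq \<Gamma> (Fun a s s' U T) (Fun a s s' U T) (Sort s0)"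
  shows "valid_eq \<Gamma> (Lam a U t) (Lam a U' t') (Fun a s s' U T)"
  unfolding valid_eq_def
proof (intro conjI allI impI)
  show "valid_ctx \<Gamma>"
    using ty by (rule valid_ctxD)
next
  fix \<rho> \<rho>' assume \<rho>: "env_rel \<Gamma> \<rho> \<rho>'"
  obtain j where "s0 = Set j"
    by (cases s0)
  then obtain c where c: "type_eq (Fun a s s' U T) \<rho> \<rho>' c"
    using valid_eq_sortD[OF _ \<rho>] ty unfolding type_eq_def by (blast intro: is_type_at)
  obtain d S where d: "c = SPi a d S" "type_eq U \<rho> \<rho>' d"
    and S: "\<And>x y. irr a (El' d) x y \<Longrightarrow> is_type (interp T (case_nat x \<rho>)) (S x)"
    using type_eq_funE[OF c] by metis
  have "El' (S x) (interp t (case_nat x \<rho>)) (interp t' (case_nat y \<rho>'))" if "irr a (El' d) x y" for x y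
    using valid_eq_El[OF t env_rel_Cons[OF \<rho> d(2) that]] S[OF that] by blast
  then have "El' c (interp (Lam a U t) \<rho>) (interp (Lam a U' t') \<rho>')"
    by (simp add: d(1))
  with c show "\<exists>c. type_eq (Fun a s s' U T) \<rho> \<rho>' c \<and>
      El' c (interp (Lam a U t) \<rho>) (interp (Lam a U' t') \<rho>')"
    by blast
qed

text \<open>Stating the assumption on \<open>u\<close> through \<open>irr\<close> covers both
  annotations. Its first half gives the result type one meaning in both environments; its second
  half relates the applications.\<close>

lemma valid_eq_app:
  assumes t: "valid_eq \<Gamma> t t' (Fun a s s' U T)"
    and u: "\<And>\<rho> \<rho>' c. env_rel \<Gamma> \<rho> \<rho>' \<Longrightarrow> type_eq U \<rho> \<rho>' c \<Longrightarrow>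
      irr a (El' c) (interp u \<rho>) (interp u \<rho>') \<and> irr a (El' c) (interp u \<rho>) (interp u' \<rho>')"
  shows "valid_eq \<Gamma> (App a t u) (App a t' u') (subst 0 u T)"
  unfolding valid_eq_def
proof (intro conjI allI impI)
  show "valid_ctx \<Gamma>"
    using t by (rule valid_ctxD)
next
  fix \<rho> \<rho>' assume \<rho>: "env_rel \<Gamma> \<rho> \<rho>'"
  obtain c where c: "type_eq (Fun a s s' U T) \<rho> \<rho>' c" "El' c (interp t \<rho>) (interp t' \<rho>')"
    using valid_eqD[OF t \<rho>] by blast
  obtain d S where d: "c = SPi a d S" "type_eq U \<rho> \<rho>' d"
    and S: "\<And>x y. irr a (El' d) x y \<Longrightarrow> is_type (interp T (case_nat x \<rho>)) (S x)"
      "\<And>x y. irr a (El' d) x y \<Longrightarrow> is_type (interp T (case_nat y \<rho>')) (S x)"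
    using type_eq_funE[OF c(1)] by metis
  let ?c = "S (interp u \<rho>)"
  have "type_eq (subst 0 u T) \<rho> \<rho>' ?c"
    using u[OF \<rho> d(2)] S unfolding type_eq_def interp_subst_0 by blast
  moreover have "El' ?c (interp (App a t u) \<rho>) (interp (App a t' u') \<rho>')"
    using c(2) d(1) u[OF \<rho> d(2)] by simp
  ultimately show "\<exists>c. type_eq (subst 0 u T) \<rho> \<rho>' c \<and>
      El' c (interp (App a t u) \<rho>) (interp (App a t' u') \<rho>')"
    by blast
qed

lemma valid_eq_beta:
  assumes t: "valid_eq ((a, U) # \<Gamma>) t t T" and u: "valid_eq (ann_ctx a \<Gamma>) u u U"
  shows "valid_eq \<Gamma> (App a (Lam a U t) u) (subst 0 u t) (subst 0 u T)"
  unfolding valid_eq_def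
proof (intro conjI allI impI)
  show "valid_ctx \<Gamma>"
    using valid_ctxD[OF t] by simp
next
  fix \<rho> \<rho>' assume \<rho>: "env_rel \<Gamma> \<rho> \<rho>'"
  obtain c where c: "type_eq U \<rho> \<rho>' c"
    using valid_ctxD[OF t] \<rho> by auto
  show "\<exists>c. type_eq (subst 0 u T) \<rho> \<rho>' c \<and>
      El' c (interp (App a (Lam a U t) u) \<rho>) (interp (subst 0 u t) \<rho>')"
    using valid_eqD[OF t env_rel_Cons[OF \<rho> c valid_eq_ann[OF u \<rho> c]]]
    by (simp add: type_eq_def interp_subst_0)
qed

text \<open>The two sides may be different points, but a function type relates points only through
  their applications, and those agree.\<close>

lemma valid_eq_eta:
  assumes t: "valid_eq \<Gamma> t t (Fun a s s' U T)"
  shows "valid_eq \<Gamma> t (Lam a U (App a (shift 1 0 t) (Var 0))) (Fun a s s' U T)"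
  unfolding valid_eq_def
proof (intro conjI allI impI)
  show "valid_ctx \<Gamma>"
    using t by (rule valid_ctxD)
next
  fix \<rho> \<rho>' assume \<rho>: "env_rel \<Gamma> \<rho> \<rho>'"
  obtain c where c: "type_eq (Fun a s s' U T) \<rho> \<rho>' c" "El' c (interp t \<rho>) (interp t \<rho>')"
    using valid_eqD[OF t \<rho>] by blast
  from c(1) obtain d S where "c = SPi a d S"
    by (rule type_eq_funE)
  moreover have "app (interp (Lam a U (App a (shift 1 0 t) (Var 0))) \<rho>') y = app (interp t \<rho>') y" for y
    unfolding interp.simps(4) app_lam_interp by (simp add: interp_shift)
  ultimately have "El' c (interp t \<rho>) (interp (Lam a U (App a (shift 1 0 t) (Var 0))) \<rho>')"
    using c(2) by (simp del: interp.simps)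
  with c(1) show "\<exists>c. type_eq (Fun a s s' U T) \<rho> \<rho>' c \<and>
      El' c (interp t \<rho>) (interp (Lam a U (App a (shift 1 0 t) (Var 0))) \<rho>')"
    by blast
qed

lemma valid_eq_sym:
  assumes "valid_eq \<Gamma> t t' T"
  shows "valid_eq \<Gamma> t' t T"
  unfolding valid_eq_def
proof (intro conjI allI impI)
  fix \<rho> \<rho>' assume "env_rel \<Gamma> \<rho> \<rho>'"
  then obtain c where "type_eq T \<rho>' \<rho> c" "El' c (interp t \<rho>') (interp t' \<rho>)"
    using valid_eqD[OF assms env_rel_sym] by blast
  then show "\<exists>c. type_eq T \<rho> \<rho>' c \<and> El' c (interp t' \<rho>) (interp t \<rho>')"
    using per_sym type_eq_per unfolding type_eq_def by blast
qed (rule valid_ctxD[OF assms])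

lemma valid_eq_trans:
  assumes 1: "valid_eq \<Gamma> t1 t2 T" and 2: "valid_eq \<Gamma> t2 t3 T"
  shows "valid_eq \<Gamma> t1 t3 T"
  unfolding valid_eq_def
proof (intro conjI allI impI)
  fix \<rho> \<rho>' assume \<rho>: "env_rel \<Gamma> \<rho> \<rho>'"
  obtain c where c: "type_eq T \<rho> \<rho>' c" "El' c (interp t1 \<rho>) (interp t2 \<rho>')"
    using valid_eqD[OF 1 \<rho>] by blast
  \<comment> \<open>The change of environment is spent on the first equation; the second is read
    entirely at \<open>\<rho>'\<close>.\<close>
  have "El' c (interp t2 \<rho>') (interp t3 \<rho>')"
    using valid_eq_El[OF 2 env_rel_refl'[OF \<rho>]] c(1) by (simp add: type_eq_def)
  then show "\<exists>c. type_eq T \<rho> \<rho>' c \<and> El' c (interp t1 \<rho>) (interp t3 \<rho>')"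
    using c per_trans type_eq_per by blast
qed (rule valid_ctxD[OF 1])

lemma valid_eq_type:
  assumes "valid_eq \<Gamma> T T' (Sort s)" "env_rel \<Gamma> \<rho> \<rho>'"
  shows "\<exists>c. is_type (interp T \<rho>) c \<and> is_type (interp T' \<rho>') c"
  using assms valid_eq_sortD is_type_at by (cases s) blast

lemma valid_eq_conv:
  assumes t: "valid_eq \<Gamma> t t' T" and T: "valid_eq \<Gamma> T T' (Sort s)"
  shows "valid_eq \<Gamma> t t' T'"
  unfolding valid_eq_def
proof (intro conjI allI impI)
  fix \<rho> \<rho>' assume \<rho>: "env_rel \<Gamma> \<rho> \<rho>'"
  obtain c where c: "type_eq T \<rho> \<rho>' c" "El' c (interp t \<rho>) (interp t' \<rho>')"
    using valid_eqD[OF t \<rho>] by blast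
  \<comment> \<open>Comparing \<open>T\<close> with \<open>T'\<close> over the pair
    \<open>\<rho>\<close>, \<open>\<rho>\<close> carries the tree of \<open>T\<close> to
    \<open>T'\<close> within a single environment.\<close>
  have "is_type (interp T' \<rho>) c"
    using valid_eq_type[OF T env_rel_refl[OF \<rho>]] c(1) is_type_unique unfolding type_eq_def by blast
  moreover have "is_type (interp T' \<rho>') c"
    using valid_eq_type[OF T \<rho>] c(1) is_type_unique unfolding type_eq_def by blast
  ultimately show "\<exists>c. type_eq T' \<rho> \<rho>' c \<and> El' c (interp t \<rho>) (interp t' \<rho>')"
    using c(2) unfolding type_eq_def by blast
qed (rule valid_ctxD[OF t])

lemma valid_eq_refl_left: "valid_eq \<Gamma> t t' T \<Longrightarrow> valid_eq \<Gamma> t t T"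
  using valid_eq_trans valid_eq_sym by blast

section \<open>Soundness, and the empty type as a value of \<open>X\<close>\<close>

theorem soundness:
  "wf_ctx \<Gamma> \<Longrightarrow> valid_ctx \<Gamma>"
  "has_type \<Gamma> t T \<Longrightarrow> valid_eq \<Gamma> t t T"
  "eq_tm \<Gamma> t t' T \<Longrightarrow> valid_eq \<Gamma> t t' T"
proof (induction rule: wf_ctx_has_type_eq_tm.inducts)
  case wf_empty
  show ?case by simp
next
  case (wf_ext \<Gamma> T s a)
  then show ?case
    using valid_eq_type unfolding type_eq_def valid_ctx.simps by blast
next
  case (ty_sort \<Gamma> s s')
  then obtain i where "s = Set i" "s' = Set (Suc i)"
    by (auto simp: Axiom_def)
  moreover have "type_at (Suc i) (sort_point i) (SSet i)"
    by (simp add: type_code_sort)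
  ultimately show ?case
    using ty_sort by (auto intro!: valid_eq_sortI)
next
  case (ty_fun \<Gamma> U s1 a T s2 s3)
  then show ?case
    using valid_eq_fun by (auto simp: Rule_def)
next
  case (ty_var \<Gamma> i U)
  then show ?case
    using env_rel_nth by (simp add: valid_eq_def)
next
  case (ty_lam a U \<Gamma> t T s s' s0)
  then show ?case by (blast intro: valid_eq_lam)
next
  case (ty_app \<Gamma> t a s s' U T u)
  then show ?case by (blast intro: valid_eq_app valid_eq_ann)
next
  case (ty_conv \<Gamma> t T T' s)
  then show ?case by (blast intro: valid_eq_conv)
next
  case (eq_beta a U \<Gamma> t T u)
  then show ?case by (blast intro: valid_eq_beta)
next
  case (eq_eta \<Gamma> t a s s' U T)
  then show ?case by (blast intro: valid_eq_eta)
next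
  case (eq_refl \<Gamma> t T)
  then show ?case by blast
next
  case (eq_sym \<Gamma> t t' T)
  then show ?case by (blast intro: valid_eq_sym)
next
  case (eq_trans \<Gamma> t1 t2 T t3)
  then show ?case by (blast intro: valid_eq_trans)
next
  case (eq_fun \<Gamma> U U' s1 a T T' s2 s3)
  then show ?case
    using valid_eq_fun by (auto simp: Rule_def)
next
  case (eq_lam \<Gamma> U U' s1 a T s2 t t')
  obtain i j where "s1 = Set i" "s2 = Set j"
    by (cases s1, cases s2)
  \<comment> \<open>The function type is valid because \<open>U\<close>, as the left side of a valid
    equation, is valid against itself.\<close>
  then have "valid_eq \<Gamma> (Fun a s1 s2 U T) (Fun a s1 s2 U T) (Sort (Set (max i j)))"
    using eq_lam.IH valid_eq_fun valid_eq_refl_left by blast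
  then show ?case
    using eq_lam.IH by (blast intro: valid_eq_lam)
next
  case (eq_app_rel \<Gamma> t t' s s' U T u u')
  have "El' c (interp u \<rho>) (interp u \<rho>') \<and> El' c (interp u \<rho>) (interp u' \<rho>')"
    if "env_rel \<Gamma> \<rho> \<rho>'" "type_eq U \<rho> \<rho>' c" for \<rho> \<rho>' c
    using that valid_eq_El[OF eq_app_rel.IH(2)] valid_eq_El[OF valid_eq_refl_left[OF eq_app_rel.IH(2)]]
    by (auto simp: type_eq_def)
  then show ?case
    using eq_app_rel.IH(1) by (intro valid_eq_app) auto
next
  case (eq_app_irr \<Gamma> t t' s s' U T u u')
  \<comment> \<open>These three memberships are exactly what the two \<open>irr\<close> conditions
    of \<open>valid_eq_app\<close> unfold to.\<close>
  have "El' c (interp u \<rho>) (interp u \<rho>) \<and> El' c (interp u \<rho>') (interp u \<rho>') \<and>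
      El' c (interp u' \<rho>') (interp u' \<rho>')"
    if "env_rel \<Gamma> \<rho> \<rho>'" "type_eq U \<rho> \<rho>' c" for \<rho> \<rho>' c
    using valid_eq_ann[of Irrelevant, OF _ that] eq_app_irr.IH(2,3) by simp
  then show ?case
    using eq_app_irr.IH(1) by (intro valid_eq_app) auto
next
  case (eq_conv \<Gamma> t t' T T' s)
  then show ?case by (blast intro: valid_eq_conv)
qed

theorem theorem5p11:
  "\<not> (\<exists>t. has_type [(Relevant, Sort (Set 0))] t (Var 0))"
proof
  assume "\<exists>t. has_type [(Relevant, Sort (Set 0))] t (Var 0)"
  then obtain t where t: "valid_eq [(Relevant, Sort (Set 0))] t t (Var 0)"
    using soundness(2) by blast
  \<comment> \<open>Index 0 interprets \<open>X\<close>; the values at other indices lie outside the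
    context and are arbitrary.\<close>
  let ?\<rho> = "\<lambda>_. empty_point"
  have empty: "type_at 0 empty_point SEmpty"
    by (rule type_code_empty)
  then have "env_rel [(Relevant, Sort (Set 0))] ?\<rho> ?\<rho>"
    by (auto simp: type_eq_def univ_iff)
  \<comment> \<open>The value of \<open>t\<close> would be related to itself by
    \<open>El' SEmpty\<close>, the empty relation.\<close>
  then show False
    using valid_eq_El[OF t] is_type_at[OF empty] by fastforce
qed

end
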